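(* Fix $\zeta>0$ and $s\in\mathbb{R}$. For each positive integer $M$, let $\gamma_M\sim\mathrm{Gamma}(M,\zeta)$ be the instantaneous SNR of the MISO maximum-ratio-transmission channel with $M$ transmit antennas, let $\mu_M = \mathbb{E}[\log(1+\gamma_M)]$ and $\sigma_M^2 = \mathrm{Var}[\log(1+\gamma_M)]$, and let $$\mathcal{M}^{\mathrm{as}}_{M}(s) = e^{(s-1)\mu_M + (s-1)^2\frac{\sigma_M^2}{2}}$$ be the Mellin transform associated with the Gaussian approximation of the service process. Then, as $M\to\infty$, $\mathcal{M}^{\mathrm{as}}_{M}(s)$ is asymptotically equivalent to $(1+\zeta M)^{s-1}$, i.e. $$\lim_{M\to\infty}\frac{\mathcal{M}^{\mathrm{as}}_{M}(s)}{(1+\zeta M)^{s-1}} = 1.$$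
   Context: $\mathrm{Gamma}(M,\zeta)$ is the gamma distribution with shape parameter $M$ and scale parameter $\zeta$, with density $\frac{x^{M-1}e^{-x/\zeta}}{\Gamma(M)\zeta^M}$ for $x\ge 0$. $\log$ is the natural logarithm. The Gaussian approximation replaces the mutual information $\log(1+\gamma_M)$ by a Gaussian random variable $\mathcal{I}$ with the same mean $\mu_M$ and variance $\sigma_M^2$; the associated Mellin transform is $\mathbb{E}[e^{(s-1)\mathcal{I}}]$, which equals the displayed expression for $\mathcal{M}^{\mathrm{as}}_{M}(s)$. *)

theory Defs
  imports "HOL-Probability.Probability"
begin

definition gamma_density :: "nat \<Rightarrow> real \<Rightarrow> real \<Rightarrow> real" where
  "gamma_density M \<zeta> x =
     (if x < 0 then 0 else x ^ (M - 1) * exp (- x / \<zeta>) / (Gamma (real M) * \<zeta> ^ M))"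

text \<open>For integer shape this is the Erlang density, with rate \<open>1 / \<zeta>\<close> and the shape shifted by one.\<close>

lemma gamma_density_eq_erlang_density:
  assumes "M \<ge> 1" and "\<zeta> > 0"
  shows "gamma_density M \<zeta> = erlang_density (M - 1) (1 / \<zeta>)"
proof -
  obtain k where M: "M = Suc k"
    using assms(1) by (cases M) auto
  have "Gamma (real (Suc k)) = fact k"
    using Gamma_fact[of k, where 'a = real] by (simp add: add.commute)
  then show ?thesis
    using assms(2) by (auto simp: M fun_eq_iff gamma_density_def erlang_density_def field_simps
      simp del: of_nat_Suc)
qed

definition mutual_info :: "('a \<Rightarrow> real) \<Rightarrow> 'a \<Rightarrow> real" where
  "mutual_info \<gamma> \<omega> = ln (1 + \<gamma> \<omega>)"

definition info_mean :: "'a measure \<Rightarrow> ('a \<Rightarrow> real) \<Rightarrow> real" where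
  "info_mean P \<gamma> = prob_space.expectation P (mutual_info \<gamma>)"

definition info_var :: "'a measure \<Rightarrow> ('a \<Rightarrow> real) \<Rightarrow> real" where
  "info_var P \<gamma> = prob_space.variance P (mutual_info \<gamma>)"

definition mellin_as :: "'a measure \<Rightarrow> ('a \<Rightarrow> real) \<Rightarrow> real \<Rightarrow> real" where
  "mellin_as P \<gamma> s = exp ((s - 1) * info_mean P \<gamma> + (s - 1)\<^sup>2 * (info_var P \<gamma> / 2))"

text \<open>\<open>mellin_as\<close> is the Mellin transform of \<open>exp I\<close> for the Gaussian \<open>I\<close> with the
  mean and variance of the mutual information.\<close>

lemma mellin_as_eq_gaussian_expectation:
  assumes "prob_space Q" and "info_var P \<gamma> > 0"
    and "distributed Q lborel I (normal_density (info_mean P \<gamma>) (sqrt (info_var P \<gamma>)))"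
  shows "prob_space.expectation Q (\<lambda>\<omega>. exp ((s - 1) * I \<omega>)) = mellin_as P \<gamma> s"
proof -
  define m v t where "m = info_mean P \<gamma>" and "v = info_var P \<gamma>" and "t = s - 1"
  have v: "v > 0" using assms(2) by (simp add: v_def)
  have "prob_space.expectation Q (\<lambda>\<omega>. exp (t * I \<omega>))
      = (\<integral>x. normal_density m (sqrt v) x * exp (t * x) \<partial>lborel)"
    using assms(3) by (subst distributed_integral[symmetric, where f = "normal_density m (sqrt v)"
      and N = lborel]) (auto simp: m_def v_def)
  also have "\<dots> = (\<integral>x. exp (t * m + t\<^sup>2 * (v / 2)) * normal_density (m + t * v) (sqrt v) x \<partial>lborel)"
  proof (rule Bochner_Integration.integral_cong[OF refl])
    fix x :: real
    have "- (x - m)\<^sup>2 / (2 * v) + t * x = t * m + t\<^sup>2 * (v / 2) + (- (x - (m + t * v))\<^sup>2 / (2 * v))"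
      using v by (simp add: field_simps power2_eq_square)
    then have "exp (- (x - m)\<^sup>2 / (2 * v)) * exp (t * x)
        = exp (t * m + t\<^sup>2 * (v / 2)) * exp (- (x - (m + t * v))\<^sup>2 / (2 * v))"
      by (metis exp_add)
    then show "normal_density m (sqrt v) x * exp (t * x)
        = exp (t * m + t\<^sup>2 * (v / 2)) * normal_density (m + t * v) (sqrt v) x"
      using v by (simp add: normal_density_def)
  qed
  also have "\<dots> = exp (t * m + t\<^sup>2 * (v / 2))"
    using v by simp
  finally show ?thesis
    by (simp add: mellin_as_def m_def v_def t_def)
qed

end

theory Submission
  imports Defs "HOL-Real_Asymp.Real_Asymp"
begin

text \<open>Put \<open>c = \<zeta> * M\<close>. Since \<open>(ln x)\<^sup>2 \<le> 4 * (x - 1)\<^sup>2 / x\<close>, the mean square deviation of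
  \<open>ln (1 + \<gamma>)\<close> from \<open>ln (1 + c)\<close> is at most \<open>4 / (1 + c)\<close> times the expectation of
  \<open>(\<gamma> - c)\<^sup>2 / \<gamma>\<close>. The latter only involves the moments of order \<open>1\<close>, \<open>0\<close> and \<open>-1\<close> of the gamma
  distribution and equals \<open>c / (M - 1)\<close>. So the mean square deviation is \<open>O(1 / M)\<close>, and it
  bounds both the variance and the squared bias \<open>(\<mu> - ln (1 + c))\<^sup>2\<close> in the exponent.\<close>

text \<open>With \<open>x = t^2\<close> the right side becomes \<open>4 * (t - 1 / t)^2\<close>, so
  it suffices to compare \<open>ln t\<close> with \<open>t - 1 / t\<close> in absolute value. This
  follows from \<open>ln y \<le> y - 1\<close>, taken at \<open>y = t\<close> when
  \<open>t \<ge> 1\<close> and at \<open>y = 1 / t\<close> otherwise.\<close>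

lemma ln_squared_le:
  fixes x :: real
  assumes "x > 0"
  shows "(ln x)\<^sup>2 \<le> 4 * ((x - 1)\<^sup>2 / x)"
proof -
  define t where "t = sqrt x"
  have t: "t > 0" "x = t\<^sup>2"
    using assms by (auto simp: t_def)
  have ln_x: "ln x = 2 * ln t"
    using t by (simp add: ln_realpow)
  have upper: "ln t \<le> t - 1"
    using t by (intro ln_le_minus_one)
  have lower: "- ln t \<le> 1 / t - 1"
    using t ln_le_minus_one[of "1 / t"] by (simp add: ln_div)
  have "\<bar>ln t\<bar> \<le> \<bar>t - 1 / t\<bar>"
  proof (cases "t \<ge> 1")
    case True
    then have "1 / t \<le> 1" "ln t \<ge> 0" by auto
    then show ?thesis using upper by linarith
  next
    case False
    then have "1 \<le> 1 / t" "ln t \<le> 0" using t by auto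
    then show ?thesis using lower False by linarith
  qed
  then have "(ln t)\<^sup>2 \<le> (t - 1 / t)\<^sup>2"
    by (simp add: abs_le_square_iff)
  also have "(t - 1 / t)\<^sup>2 = (x - 1)\<^sup>2 / x"
    using t by (simp add: field_simps power2_eq_square)
  finally show ?thesis
    by (simp add: ln_x power_mult_distrib)
qed

lemma ln_one_plus_diff_squared_le:
  fixes x c :: real
  assumes "x > 0" "c > 0"
  shows "(ln (1 + x) - ln (1 + c))\<^sup>2 \<le> 4 / (1 + c) * ((x - c)\<^sup>2 / x)"
proof -
  have "(ln (1 + x) - ln (1 + c))\<^sup>2 = (ln ((1 + x) / (1 + c)))\<^sup>2"
    using assms by (simp add: ln_div)
  also have "\<dots> \<le> 4 * (((1 + x) / (1 + c) - 1)\<^sup>2 / ((1 + x) / (1 + c)))"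
    using assms by (intro ln_squared_le) auto
  also have "(1 + x) / (1 + c) - 1 = (x - c) / (1 + c)"
    using assms by (simp add: field_simps)
  also have "4 * (((x - c) / (1 + c))\<^sup>2 / ((1 + x) / (1 + c))) = 4 / (1 + c) * ((x - c)\<^sup>2 / (1 + x))"
    using assms by (simp add: power2_eq_square)
  \<comment> \<open>Weakening \<open>1 + x\<close> to \<open>x\<close> leaves a denominator whose
    gamma expectation is explicit.\<close>
  also have "\<dots> \<le> 4 / (1 + c) * ((x - c)\<^sup>2 / x)"
    using assms by (intro mult_left_mono divide_left_mono) auto
  finally show ?thesis .
qed

lemma has_bochner_integral_erlang_density:
  assumes "l > 0"
  shows "has_bochner_integral lborel (erlang_density k l) 1"
proof -
  interpret prob_space "density lborel (erlang_density k l)"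
    using assms by (rule prob_space_erlang_density)
  have "(\<integral>\<^sup>+x. ennreal (erlang_density k l x) \<partial>lborel) = ennreal 1"
    using emeasure_space_1 by (simp add: emeasure_density)
  then show ?thesis
    using assms by (intro has_bochner_integral_nn_integral) auto
qed

text \<open>Shifting the shape turns the moments of order 1 and -1 into total masses of neighbouring
  Erlang densities, so no moment has to be integrated directly.\<close>

lemma erlang_density_times:
  assumes "l > 0"
  shows "erlang_density k l x * x = (real k + 1) / l * erlang_density (Suc k) l x"
proof -
  have "real k + 1 \<noteq> 0" by linarith
  then show ?thesis
    using assms by (simp add: erlang_density_def divide_simps)
qed

text \<open>The shape shift read backwards. At \<open>x = 0\<close> it fails for
  \<open>k = 0\<close>: the left side is 0 since \<open>y / 0 = 0\<close>, the right side is
  \<open>l^2\<close>.\<close>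

lemma erlang_density_divide:
  assumes "l > 0" "x \<noteq> 0"
  shows "erlang_density (Suc k) l x / x = l / (real k + 1) * erlang_density k l x"
  using erlang_density_times[OF assms(1), of k x] assms
  by (simp add: divide_simps add_nonneg_eq_0_iff) (simp add: algebra_simps)

text \<open>Here \<open>c\<close> is the mean of the Erlang law of shape \<open>k + 2\<close> and
  rate \<open>l\<close>. Expanding the quotient as \<open>x - 2 * c + c^2 / x\<close> gives three
  multiples of Erlang densities, each of mass 1. Shape at least 2 keeps the moment of order -1
  finite.\<close>

lemma has_bochner_integral_erlang_density_dev:
  assumes "l > 0" "c = (real k + 2) / l"
  shows "has_bochner_integral lborel
    (\<lambda>x. erlang_density (Suc k) l x * ((x - c)\<^sup>2 / x)) (c / (real k + 1))"
proof -
  have eq: "c * erlang_density (Suc (Suc k)) l x - 2 * c * erlang_density (Suc k) l x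
      + c\<^sup>2 * (l / (real k + 1)) * erlang_density k l x
      = erlang_density (Suc k) l x * ((x - c)\<^sup>2 / x)" if "x \<noteq> 0" for x
  proof -
    have "erlang_density (Suc k) l x * ((x - c)\<^sup>2 / x)
        = erlang_density (Suc k) l x * x - 2 * c * erlang_density (Suc k) l x
          + c\<^sup>2 * (erlang_density (Suc k) l x / x)"
      using that by (simp add: field_simps power2_eq_square)
    also have "erlang_density (Suc k) l x * x = c * erlang_density (Suc (Suc k)) l x"
      using erlang_density_times[OF assms(1), of "Suc k" x] assms(2) by simp
    finally show ?thesis
      using erlang_density_divide[OF assms(1) that, of k] by simp
  qed
  have "has_bochner_integral lborel
      (\<lambda>x. c * erlang_density (Suc (Suc k)) l x - 2 * c * erlang_density (Suc k) l x
        + c\<^sup>2 * (l / (real k + 1)) * erlang_density k l x)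
      (c * 1 - 2 * c * 1 + c\<^sup>2 * (l / (real k + 1)) * 1)"
    using assms(1) by (intro has_bochner_integral_add has_bochner_integral_diff
      has_bochner_integral_mult_right has_bochner_integral_erlang_density)
  also have "?this \<longleftrightarrow> has_bochner_integral lborel
      (\<lambda>x. erlang_density (Suc k) l x * ((x - c)\<^sup>2 / x))
      (c * 1 - 2 * c * 1 + c\<^sup>2 * (l / (real k + 1)) * 1)"
  proof (rule has_bochner_integral_cong_AE)
    show "AE x in lborel. c * erlang_density (Suc (Suc k)) l x - 2 * c * erlang_density (Suc k) l x
        + c\<^sup>2 * (l / (real k + 1)) * erlang_density k l x
        = erlang_density (Suc k) l x * ((x - c)\<^sup>2 / x)"
      using AE_lborel_singleton[of 0] by eventually_elim (rule eq)
  qed measurable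
  \<comment> \<open>As \<open>c * l = k + 2\<close>, the last summand is
    \<open>c * (k + 2) / (k + 1)\<close>.\<close>
  also have "c * 1 - 2 * c * 1 + c\<^sup>2 * (l / (real k + 1)) * 1 = c / (real k + 1)"
  proof -
    have "real k + 1 \<noteq> 0" by linarith
    then show ?thesis
      using assms by (simp add: divide_simps power2_eq_square) (simp add: algebra_simps)
  qed
  finally show ?thesis .
qed

text \<open>Bias-variance decomposition. On a probability space, square integrability of
  \<open>X - c\<close> already makes \<open>X\<close> integrable.\<close>

lemma (in prob_space) expectation_square_dev:
  fixes X :: "'a \<Rightarrow> real"
  assumes [measurable]: "random_variable borel X"
    and int: "integrable M (\<lambda>x. (X x - c)\<^sup>2)"
  shows "expectation (\<lambda>x. (X x - c)\<^sup>2) = variance X + (expectation X - c)\<^sup>2"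
proof -
  define Y where "Y = (\<lambda>x. X x - c)"
  have Y2: "integrable M (\<lambda>x. (Y x)\<^sup>2)" and [measurable]: "random_variable borel Y"
    using int by (simp_all add: Y_def)
  then have Y: "integrable M Y"
    by (rule square_integrable_imp_integrable[rotated])
  have X: "X = (\<lambda>x. Y x + c)"
    by (simp add: Y_def)
  have "expectation X = expectation Y + c"
    unfolding X using Y by (simp add: prob_space)
  moreover from this have "variance X = variance Y"
    by (simp add: Y_def algebra_simps)
  ultimately show ?thesis
    using variance_eq[OF Y Y2] by (simp add: Y_def)
qed

text \<open>The left side is the mean square deviation of the mutual information from
  \<open>ln (1 + c)\<close>. It is bounded by integrating the pointwise logarithm estimate against
  the density.\<close>

lemma (in prob_space) info_var_plus_bias_le:
  assumes dist: "distributed M lborel X (erlang_density (Suc k) l)"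
    and "l > 0" and c: "c = (real k + 2) / l"
  shows "info_var M X + (info_mean M X - ln (1 + c))\<^sup>2 \<le> 4 / (real k + 1)"
proof -
  define g where "g = (\<lambda>x. (ln (1 + x) - ln (1 + c))\<^sup>2)"
  define h where "h = (\<lambda>x. 4 / (1 + c) * (erlang_density (Suc k) l x * ((x - c)\<^sup>2 / x)))"
  have "c > 0"
    using c \<open>l > 0\<close> by simp
  have X[measurable]: "random_variable borel X"
    using distributed_measurable[OF dist] unfolding measurable_lborel1 .
  have [measurable]: "g \<in> borel_measurable borel"
    unfolding g_def by measurable
  have h: "has_bochner_integral lborel h (4 / (1 + c) * (c / (real k + 1)))"
    unfolding h_def
    by (intro has_bochner_integral_mult_right has_bochner_integral_erlang_density_dev assms)
  have le: "erlang_density (Suc k) l x * g x \<le> h x" for x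
  proof (cases "x > 0")
    case True
    then have "g x \<le> 4 / (1 + c) * ((x - c)\<^sup>2 / x)"
      unfolding g_def using \<open>c > 0\<close> by (rule ln_one_plus_diff_squared_le)
    then have "erlang_density (Suc k) l x * g x
        \<le> erlang_density (Suc k) l x * (4 / (1 + c) * ((x - c)\<^sup>2 / x))"
      using \<open>l > 0\<close> by (intro mult_left_mono) auto
    then show ?thesis
      by (simp add: h_def mult_ac)
  next
    case False
    \<comment> \<open>At \<open>x = 0\<close> the density vanishes because its power of
      \<open>x\<close> has the positive exponent \<open>Suc k\<close>.\<close>
    then have "erlang_density (Suc k) l x = 0"
      by (cases "x = 0") (auto simp: erlang_density_def)
    then show ?thesis
      by (simp add: h_def)
  qed
  have nonneg: "0 \<le> erlang_density (Suc k) l x" "0 \<le> erlang_density (Suc k) l x * g x" for x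
    using \<open>l > 0\<close> by (auto simp: g_def)
  have int: "integrable lborel (\<lambda>x. erlang_density (Suc k) l x * g x)"
  proof (rule Bochner_Integration.integrable_bound)
    show "integrable lborel h"
      using h by (simp add: has_bochner_integral_iff)
    show "AE x in lborel. norm (erlang_density (Suc k) l x * g x) \<le> norm (h x)"
    proof (rule AE_I2)
      fix x
      show "norm (erlang_density (Suc k) l x * g x) \<le> norm (h x)"
        using le[of x] nonneg(2)[of x] unfolding real_norm_def by linarith
    qed
  qed measurable
  then have "integrable M (\<lambda>\<omega>. g (X \<omega>))"
    using distributed_integrable[OF dist, of g] nonneg by simp
  then have "integrable M (\<lambda>\<omega>. (mutual_info X \<omega> - ln (1 + c))\<^sup>2)"
    by (simp add: g_def mutual_info_def)
  moreover have "random_variable borel (mutual_info X)"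
    unfolding mutual_info_def by measurable
  ultimately have "info_var M X + (info_mean M X - ln (1 + c))\<^sup>2 = expectation (\<lambda>\<omega>. g (X \<omega>))"
    using expectation_square_dev[of "mutual_info X" "ln (1 + c)"]
    by (simp add: info_var_def info_mean_def g_def mutual_info_def)
  also have "\<dots> = (\<integral>x. erlang_density (Suc k) l x * g x \<partial>lborel)"
    using distributed_integral[OF dist, of g] nonneg by simp
  also have "\<dots> \<le> integral\<^sup>L lborel h"
    using int h le by (intro integral_mono) (auto simp: has_bochner_integral_iff)
  also have "\<dots> = 4 / (1 + c) * (c / (real k + 1))"
    using h by (simp add: has_bochner_integral_iff)
  also have "\<dots> = c / (1 + c) * (4 / (real k + 1))"
    by simp
  \<comment> \<open>Bounding \<open>c / (1 + c)\<close> by 1 makes the estimate independent of the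
    rate \<open>l\<close>.\<close>
  also have "\<dots> \<le> 1 * (4 / (real k + 1))"
    using \<open>c > 0\<close> by (intro mult_right_mono) auto
  finally show ?thesis
    by simp
qed

theorem theorem5:
  fixes \<zeta> s :: real and P :: "nat \<Rightarrow> 'a measure" and \<gamma> :: "nat \<Rightarrow> 'a \<Rightarrow> real"
  assumes "\<zeta> > 0"
    and "\<And>M. M \<ge> 1 \<Longrightarrow> prob_space (P M)"
    and "\<And>M. M \<ge> 1 \<Longrightarrow> distributed (P M) lborel (\<gamma> M) (gamma_density M \<zeta>)"
  shows "(\<lambda>M. mellin_as (P M) (\<gamma> M) s / (1 + \<zeta> * real M) powr (s - 1)) \<longlonglongrightarrow> 1"
proof -
  define v where "v = (\<lambda>M. info_var (P M) (\<gamma> M))"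
  define b where "b = (\<lambda>M. info_mean (P M) (\<gamma> M) - ln (1 + \<zeta> * real M))"
  define e :: "nat \<Rightarrow> real" where "e = (\<lambda>M. 4 / (real M - 1))"
  have bound: "v M + (b M)\<^sup>2 \<le> e M" and v_nonneg: "0 \<le> v M" if "M \<ge> 2" for M
  proof -
    \<comment> \<open>Shape \<open>M\<close> is Erlang index \<open>M - 1 = Suc k\<close>, so
      \<open>k + 1 = M - 1\<close> is the denominator in \<open>e\<close>.\<close>
    obtain k where M: "M = k + 2"
      using \<open>M \<ge> 2\<close> by (metis add.commute le_Suc_ex)
    interpret prob_space "P M"
      using assms(2) M by simp
    have "distributed (P M) lborel (\<gamma> M) (erlang_density (Suc k) (1 / \<zeta>))"
      using assms(3)[of M] gamma_density_eq_erlang_density[of M \<zeta>] \<open>\<zeta> > 0\<close> M by simp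
    \<comment> \<open>With rate \<open>1 / \<zeta>\<close> the centre \<open>c\<close> is
      \<open>\<zeta> * real M\<close>.\<close>
    from info_var_plus_bias_le[OF this _ refl] show "v M + (b M)\<^sup>2 \<le> e M"
      using \<open>\<zeta> > 0\<close> by (simp add: v_def b_def e_def M algebra_simps)
    show "0 \<le> v M"
      by (simp add: v_def info_var_def)
  qed
  have e: "e \<longlonglongrightarrow> 0"
    unfolding e_def by real_asymp
  have v: "v \<longlonglongrightarrow> 0"
  proof (rule tendsto_sandwich[OF _ _ tendsto_const e])
    show "eventually (\<lambda>M. 0 \<le> v M) sequentially"
      using v_nonneg by (intro eventually_sequentiallyI[of 2])
    show "eventually (\<lambda>M. v M \<le> e M) sequentially"
      using bound by (intro eventually_sequentiallyI[of 2]) (smt (verit) zero_le_power2)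
  qed
  have "(\<lambda>M. (b M)\<^sup>2) \<longlonglongrightarrow> 0"
  proof (rule tendsto_sandwich[OF _ _ tendsto_const e])
    show "eventually (\<lambda>M. (b M)\<^sup>2 \<le> e M) sequentially"
      using bound v_nonneg by (intro eventually_sequentiallyI[of 2]) fastforce
  qed auto
  then have b: "b \<longlonglongrightarrow> 0"
    by simp
  have "(\<lambda>M. exp ((s - 1) * b M + (s - 1)\<^sup>2 * (v M / 2))) \<longlonglongrightarrow> exp ((s - 1) * 0 + (s - 1)\<^sup>2 * (0 / 2))"
    by (intro tendsto_intros b v) simp
  \<comment> \<open>Writing the power as \<open>exp ((s - 1) * ln (1 + \<zeta> * real M))\<close>
    and dividing replaces the mean in the exponent by the bias \<open>b M\<close>.\<close>
  moreover have "mellin_as (P M) (\<gamma> M) s / (1 + \<zeta> * real M) powr (s - 1)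
      = exp ((s - 1) * b M + (s - 1)\<^sup>2 * (v M / 2))" for M
  proof -
    have "1 + \<zeta> * real M > 0"
      using \<open>\<zeta> > 0\<close> by (simp add: add_pos_nonneg)
    then show ?thesis
      by (simp add: mellin_as_def powr_def b_def v_def right_diff_distrib diff_add_eq
        flip: exp_diff)
  qed
  ultimately show ?thesis
    by simp
qed

end
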